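(* Let $\mathsf{M}$ be a $d\times d$ real-valued invertible matrix. Let $\Phi$ and $\Psi$ be subsets of $L_2(\mathbb{R}^d)$. Suppose that for some integer $J$ the system $\mathsf{WS}_J(\Phi;\Psi)$ is a nonhomogeneous $\mathsf{M}$-wavelet frame in $L_2(\mathbb{R}^d)$, that is, there exist positive constants $C_1$ and $C_2$ such that $$C_1\|f\|^2_{L_2(\mathbb{R}^d)}\le\sum_{\phi\in\Phi}\sum_{k\in\mathbb{Z}^d}|\langle f,\phi_{\mathsf{M}^J;k}\rangle|^2+\sum_{j=J}^\infty\sum_{\psi\in\Psi}\sum_{k\in\mathbb{Z}^d}|\langle f,\psi_{\mathsf{M}^j;k}\rangle|^2\le C_2\|f\|^2_{L_2(\mathbb{R}^d)},\qquad\forall f\in L_2(\mathbb{R}^d).$$ Then these inequalities hold, with the same $C_1$ and $C_2$, for all integers $J$; in other words, $\mathsf{WS}_J(\Phi;\Psi)$ is a nonhomogeneous $\mathsf{M}$-wavelet frame with the same lower and upper frame bounds for all integers $J$. If in addition $\mathsf{M}$ is an expansive matrix and $\sum_{\phi\in\Phi}\|\phi\|^2_{L_2(\mathbb{R}^d)}<\infty$, then the homogeneous $\mathsf{M}$-wavelet system $\mathsf{WS}(\Psi)$ is also a frame in $L_2(\mathbb{R}^d)$ with the same constants $C_1,C_2$: $$C_1\|f\|^2_{L_2(\mathbb{R}^d)}\le\sum_{j\in\mathbb{Z}}\sum_{\psi\in\Psi}\sum_{k\in\mathbb{Z}^d}|\langle f,\psi_{\mathsf{M}^j;k}\rangle|^2\le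 C_2\|f\|^2_{L_2(\mathbb{R}^d)},\qquad\forall f\in L_2(\mathbb{R}^d).$$
   Context: For $f:\mathbb{R}^d\to\mathbb{C}$, a $d\times d$ real invertible matrix $U$ and $k\in\mathbb{R}^d$, put $f_{U;k}(x):=|\det U|^{1/2}f(Ux-k)$. For subsets $\Phi,\Psi$ of $L_2(\mathbb{R}^d)$ and $J\in\mathbb{Z}$, $$\mathsf{WS}_J(\Phi;\Psi):=\{\phi_{\mathsf{M}^J;k}: k\in\mathbb{Z}^d,\phi\in\Phi\}\cup\{\psi_{\mathsf{M}^j;k}: j\ge J,\ k\in\mathbb{Z}^d,\psi\in\Psi\},\qquad \mathsf{WS}(\Psi):=\{\psi_{\mathsf{M}^j;k}: j\in\mathbb{Z},k\in\mathbb{Z}^d,\psi\in\Psi\}.$$ The sets $\Phi,\Psi$ may be infinite and their elements are not necessarily distinct; sums count elements with multiplicity. A matrix is expansive if all its eigenvalues have modulus greater than one. $\langle f,g\rangle=\int_{\mathbb{R}^d}f\overline g$. *)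

theory Defs
  imports "HOL-Analysis.Analysis"
begin

text \<open>Elements of \<open>L\<^sub>2\<close> are represented by Lebesgue measurable functions, not by classes modulo
  null sets; all quantities below are invariant under changes on null sets.\<close>

definition L2 :: "(real^'d \<Rightarrow> complex) set" where
  "L2 = {f. f \<in> borel_measurable lebesgue \<and> integrable lebesgue (\<lambda>x. (cmod (f x))\<^sup>2)}"

definition L2_inner :: "(real^'d \<Rightarrow> complex) \<Rightarrow> (real^'d \<Rightarrow> complex) \<Rightarrow> complex" where
  "L2_inner f g = (LINT x|lebesgue. f x * cnj (g x))"

definition L2_norm :: "(real^'d \<Rightarrow> complex) \<Rightarrow> real" where
  "L2_norm f = sqrt (LINT x|lebesgue. (cmod (f x))\<^sup>2)"

text \<open>The overloaded power on \<open>real^'d^'d\<close> is componentwise, so powers with respect to the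
  matrix product are defined here.\<close>

definition matrix_power :: "real^'d^'d \<Rightarrow> nat \<Rightarrow> real^'d^'d" where
  "matrix_power A n = ((\<lambda>X. A ** X) ^^ n) (mat 1)"

definition matrix_powi :: "real^'d^'d \<Rightarrow> int \<Rightarrow> real^'d^'d" where
  "matrix_powi A j =
     (if 0 \<le> j then matrix_power A (nat j) else matrix_power (matrix_inv A) (nat (- j)))"

definition expansive :: "real^'d^'d \<Rightarrow> bool" where
  "expansive A \<longleftrightarrow>
     (\<forall>(z::complex) (v::complex^'d).
        v \<noteq> 0 \<and> (\<chi> i j. complex_of_real (A $ i $ j)) *v v = z *s v \<longrightarrow> 1 < cmod z)"

definition int_lattice :: "(real^'d) set" where
  "int_lattice = {k. \<forall>i. k $ i \<in> \<int>}"

definition dilate_shift :: "real^'d^'d \<Rightarrow> real^'d \<Rightarrow> (real^'d \<Rightarrow> complex) \<Rightarrow> real^'d \<Rightarrow> complex" where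
  "dilate_shift U k f = (\<lambda>x. complex_of_real (sqrt \<bar>det U\<bar>) * f (U *v x - k))"

text \<open>The generating sets are families \<open>\<phi>\<close>, \<open>\<psi>\<close> over arbitrary index sets \<open>A\<close>, \<open>B\<close>, so that
  elements may repeat and are counted with multiplicity. The sums are taken in \<open>[0, \<infinity>]\<close>, where
  every family has an unordered sum; real-valued sums would be \<open>0\<close> in case of divergence.\<close>

definition level_sum ::
    "real^'d^'d \<Rightarrow> int \<Rightarrow> 'i set \<Rightarrow> ('i \<Rightarrow> real^'d \<Rightarrow> complex) \<Rightarrow> (real^'d \<Rightarrow> complex) \<Rightarrow> ennreal" where
  "level_sum M j A \<phi> f =
     (\<Sum>\<^sub>\<infinity>a\<in>A. \<Sum>\<^sub>\<infinity>k\<in>int_lattice.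
        ennreal ((cmod (L2_inner f (dilate_shift (matrix_powi M j) k (\<phi> a))))\<^sup>2))"

definition nonhomogeneous_wavelet_frame ::
    "real^'d^'d \<Rightarrow> int \<Rightarrow> 'i set \<Rightarrow> ('i \<Rightarrow> real^'d \<Rightarrow> complex) \<Rightarrow> 'j set \<Rightarrow> ('j \<Rightarrow> real^'d \<Rightarrow> complex)
       \<Rightarrow> real \<Rightarrow> real \<Rightarrow> bool" where
  "nonhomogeneous_wavelet_frame M J A \<phi> B \<psi> C\<^sub>1 C\<^sub>2 \<longleftrightarrow>
     0 < C\<^sub>1 \<and> 0 < C\<^sub>2 \<and>
     (\<forall>f\<in>L2.
        ennreal (C\<^sub>1 * (L2_norm f)\<^sup>2)
          \<le> level_sum M J A \<phi> f + (\<Sum>\<^sub>\<infinity>j\<in>{J..}. level_sum M j B \<psi> f) \<and>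
        level_sum M J A \<phi> f + (\<Sum>\<^sub>\<infinity>j\<in>{J..}. level_sum M j B \<psi> f)
          \<le> ennreal (C\<^sub>2 * (L2_norm f)\<^sup>2))"

definition homogeneous_wavelet_frame ::
    "real^'d^'d \<Rightarrow> 'j set \<Rightarrow> ('j \<Rightarrow> real^'d \<Rightarrow> complex) \<Rightarrow> real \<Rightarrow> real \<Rightarrow> bool" where
  "homogeneous_wavelet_frame M B \<psi> C\<^sub>1 C\<^sub>2 \<longleftrightarrow>
     0 < C\<^sub>1 \<and> 0 < C\<^sub>2 \<and>
     (\<forall>f\<in>L2.
        ennreal (C\<^sub>1 * (L2_norm f)\<^sup>2) \<le> (\<Sum>\<^sub>\<infinity>j\<in>UNIV. level_sum M j B \<psi> f) \<and>
        (\<Sum>\<^sub>\<infinity>j\<in>UNIV. level_sum M j B \<psi> f) \<le> ennreal (C\<^sub>2 * (L2_norm f)\<^sup>2))"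

end

theory Submission
  imports Defs "HOL-Computational_Algebra.Fundamental_Theorem_Algebra"
begin

text \<open>The dilation \<open>f \<mapsto> |det M|^{n/2} f(M^n x)\<close> is a bijective isometry of
  \<open>L2\<close> and moves the inner product with a generator of level \<open>j\<close> to the inner product with the same
  generator of level \<open>j + n\<close>. It therefore carries the frame sum that starts at level \<open>J\<close> to the one
  that starts at level \<open>J + n\<close>, and since it preserves norms, the frame inequalities at one level are
  those at any other (\<open>nonhomogeneous_wavelet_frame_all_levels\<close>).

  For the homogeneous system, let \<open>J \<rightarrow> -\<infinity>\<close> in the inequalities of level \<open>J\<close>. The upper bound survives
  because every finite set of levels lies above some \<open>J\<close>. For the lower bound, the coarse part
  \<open>level_sum M J A \<phi> f\<close> must disappear. For \<open>f\<close> supported in a ball, dilate by \<open>M^n\<close> with \<open>J = -n\<close>: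
  the inner products become those of a function \<open>g\<close> with the integer translates of the \<open>\<phi> a\<close>, where
  \<open>g\<close> has the norm of \<open>f\<close> and is supported in the image of the ball under \<open>M^{-n}\<close>. As \<open>M\<close> is
  expansive, this image eventually lies in a ball of any given radius \<open>\<epsilon> \<le> 1/2\<close>
  (\<open>matrix_power_inv_small_on_ball\<close>). Its integer translates are disjoint, so the Cauchy-Schwarz
  inequality on each of them bounds the coarse part by
  \<open>norm(f)^2 * (\<Sum>a\<in>A. \<integral> |\<phi> a|^2 over the \<epsilon>-neighbourhood of the lattice)\<close> (\<open>level_sum_coarse_le\<close>).
  As \<open>\<epsilon> \<rightarrow> 0\<close> this neighbourhood shrinks to a null set, and \<open>\<Sum>a\<in>A. norm(\<phi> a)^2 < \<infinity>\<close> lets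
  dominated convergence act on the integral and on the sum (\<open>sum_energy_on_lattice_nbhd_tendsto_zero\<close>).

  A general \<open>f\<close> is split into its restriction to a large ball and a remainder \<open>r\<close>. The coarse part is
  the square of a seminorm, hence at most twice the sum of its values at the two pieces, and the upper
  frame bound, valid at every level with the same constant, controls the value at \<open>r\<close> by
  \<open>C\<^sub>2 * norm(r)^2\<close>, uniformly in \<open>J\<close> (\<open>homogeneous_sum_ge\<close>).\<close>

section \<open>Powers of matrices\<close>

lemma matrix_power_0: "matrix_power A 0 = mat 1"
  by (simp add: matrix_power_def)

lemma matrix_power_Suc: "matrix_power A (Suc n) = A ** matrix_power A n"
  by (simp add: matrix_power_def)

lemma matrix_inv_cancel:
  fixes A :: "real^'d^'d"
  assumes "invertible A"
  shows "A ** matrix_inv A = mat 1" "matrix_inv A ** A = mat 1"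
proof -
  have "A ** matrix_inv A = mat 1 \<and> matrix_inv A ** A = mat 1"
    unfolding matrix_inv_def using assms unfolding invertible_def by (rule someI_ex)
  then show "A ** matrix_inv A = mat 1" "matrix_inv A ** A = mat 1" by auto
qed

lemma invertible_matrix_inv: "invertible A \<Longrightarrow> invertible (matrix_inv (A::real^'d^'d))"
  by (metis invertible_right_inverse matrix_inv_cancel(2))

lemma matrix_powi_0: "matrix_powi A 0 = mat 1"
  by (simp add: matrix_powi_def matrix_power_0)

lemma matrix_powi_uminus_nat: "matrix_powi A (- int n) = matrix_power (matrix_inv A) n"
  by (cases "n = 0") (auto simp: matrix_powi_def matrix_power_0)

lemma matrix_powi_plus_one:
  fixes A :: "real^'d^'d"
  assumes "invertible A"
  shows "matrix_powi A (j + 1) = A ** matrix_powi A j"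
proof (cases "0 \<le> j")
  case True
  then show ?thesis by (simp add: matrix_powi_def nat_add_distrib matrix_power_Suc)
next
  case False
  define n where "n = nat (- j - 1)"
  have j: "j = - int (Suc n)" using False by (simp add: n_def)
  have "j + 1 = - int n" by (simp add: j)
  then have "matrix_powi A (j + 1) = matrix_power (matrix_inv A) n"
    by (simp only: matrix_powi_uminus_nat)
  moreover have "matrix_powi A j = matrix_inv A ** matrix_power (matrix_inv A) n"
    unfolding j matrix_powi_uminus_nat matrix_power_Suc ..
  ultimately show ?thesis
    using assms by (simp add: matrix_mul_assoc matrix_inv_cancel)
qed

lemma matrix_powi_minus_one:
  fixes A :: "real^'d^'d"
  assumes "invertible A"
  shows "matrix_powi A (j - 1) = matrix_inv A ** matrix_powi A j"
  using matrix_powi_plus_one[OF assms, of "j - 1"] assms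
  by (simp add: matrix_mul_assoc matrix_inv_cancel(2))

lemma matrix_powi_add:
  fixes A :: "real^'d^'d"
  assumes "invertible A"
  shows "matrix_powi A (i + j) = matrix_powi A i ** matrix_powi A j"
proof (induction i rule: int_induct[where k = 0])
  case base
  then show ?case by (simp add: matrix_powi_0)
next
  case (step1 i)
  then show ?case
    using matrix_powi_plus_one[OF assms, of "i + j"] matrix_powi_plus_one[OF assms, of i]
    by (simp add: algebra_simps matrix_mul_assoc)
next
  case (step2 i)
  then show ?case
    using matrix_powi_minus_one[OF assms, of "i + j"] matrix_powi_minus_one[OF assms, of i]
    by (simp add: algebra_simps matrix_mul_assoc)
qed

lemma invertible_matrix_powi:
  fixes A :: "real^'d^'d"
  assumes "invertible A"
  shows "invertible (matrix_powi A j)"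
  using matrix_powi_add[OF assms, of j "- j"] matrix_powi_0[of A]
  by (metis add.right_inverse invertible_right_inverse)

text \<open>The value at \<open>v\<close> of the operator \<open>p(A)\<close>.\<close>

definition poly_act :: "complex poly \<Rightarrow> complex^'d^'d \<Rightarrow> complex^'d \<Rightarrow> complex^'d" where
  "poly_act p A v = (\<Sum>i\<le>degree p. coeff p i *s (((*v) A ^^ i) v))"

lemma poly_act_eq:
  assumes "degree p \<le> n"
  shows "poly_act p A v = (\<Sum>i\<le>n. coeff p i *s (((*v) A ^^ i) v))"
  unfolding poly_act_def using assms
  by (intro sum.mono_neutral_left) (auto simp: coeff_eq_0)

lemma funpow_matrix_vector_diff:
  fixes A :: "complex^'d^'d"
  shows "((*v) A ^^ i) (x - y) = ((*v) A ^^ i) x - ((*v) A ^^ i) y"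
  by (induction i) (simp_all add: matrix_vector_mult_diff_distrib)

lemma funpow_matrix_vector_scale:
  fixes A :: "complex^'d^'d"
  shows "((*v) A ^^ i) (c *s x) = c *s ((*v) A ^^ i) x"
  by (induction i) (simp_all add: vector_scalar_commute)

lemma poly_act_linear_factor:
  "poly_act ([:- a, 1:] * q) A v = poly_act q A (A *v v - a *s v)"
proof -
  define n where "n = degree q"
  let ?T = "\<lambda>i v. ((*v) A ^^ i) v"
  have "degree ([:- a, 1:] * q) \<le> Suc n"
    unfolding n_def by (rule order_trans[OF degree_mult_le]) simp
  then have "poly_act ([:- a, 1:] * q) A v = (\<Sum>i\<le>Suc n. coeff ([:- a, 1:] * q) i *s ?T i v)"
    by (rule poly_act_eq)
  also have "\<dots> = (\<Sum>i\<le>Suc n. coeff (pCons 0 q) i *s ?T i v) - (\<Sum>i\<le>Suc n. (a * coeff q i) *s ?T i v)"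
    unfolding sum_subtractf[symmetric]
    by (intro sum.cong refl) (simp add: vec.scale_left_diff_distrib)
  also have "(\<Sum>i\<le>Suc n. coeff (pCons 0 q) i *s ?T i v) = (\<Sum>i\<le>n. coeff q i *s ?T (Suc i) v)"
    by (subst sum.atMost_Suc_shift) simp
  also have "(\<Sum>i\<le>Suc n. (a * coeff q i) *s ?T i v) = (\<Sum>i\<le>n. (a * coeff q i) *s ?T i v)"
    by (simp add: n_def coeff_eq_0)
  also have "(\<Sum>i\<le>n. coeff q i *s ?T (Suc i) v) - (\<Sum>i\<le>n. (a * coeff q i) *s ?T i v)
      = (\<Sum>i\<le>n. coeff q i *s ?T i (A *v v - a *s v))"
    unfolding sum_subtractf[symmetric]
    by (intro sum.cong refl)
      (simp add: funpow_matrix_vector_diff funpow_matrix_vector_scale vec.scale_right_diff_distrib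
        funpow_Suc_right mult.commute del: funpow.simps(2))
  also have "\<dots> = poly_act q A (A *v v - a *s v)"
    by (simp add: poly_act_def n_def)
  finally show ?thesis .
qed

text \<open>Among the \<open>d + 1\<close> vectors \<open>v, A v, ..., A^d v\<close> of a space of dimension \<open>d\<close> there is a linear relation.
  If two of them coincide, the set of these vectors is too small for a dimension count, but then
  \<open>A^i v - A^j v = 0\<close> is such a relation.\<close>

lemma ex_annihilating_poly:
  fixes A :: "complex^'d^'d"
  shows "\<exists>p. p \<noteq> 0 \<and> poly_act p A v = 0"
proof -
  let ?T = "\<lambda>i. ((*v) A ^^ i) v" and ?d = "CARD('d)"
  have "\<exists>u. (\<exists>i\<le>?d. u i \<noteq> 0) \<and> (\<Sum>i\<le>?d. u i *s ?T i) = 0"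
  proof (cases "inj_on ?T {..?d}")
    case True
    then have "card (?T ` {..?d}) = Suc ?d" by (simp add: card_image)
    moreover have "vec.dim (?T ` {..?d}) \<le> ?d"
      using vec.dim_subset_UNIV[of "?T ` {..?d}"] vec_dim_card[where ?'a=complex and ?'n='d] by (simp add: vec.dimension_def)
    ultimately have "vec.dependent (?T ` {..?d})"
      by (intro vec.dependent_biggerset_general) simp
    then obtain u where u: "\<exists>w\<in>?T ` {..?d}. u w \<noteq> 0" "(\<Sum>w\<in>?T ` {..?d}. u w *s w) = 0"
      by (auto simp: vec.dependent_finite)
    show ?thesis
      using u by (intro exI[of _ "\<lambda>i. u (?T i)"]) (auto simp: sum.reindex[OF True])
  next
    case False
    then obtain i j where ij: "i \<le> ?d" "j \<le> ?d" "i \<noteq> j" "?T i = ?T j"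
      by (auto simp: inj_on_def)
    define u where "u l = (if l = i then 1 else if l = j then - 1 else 0 :: complex)" for l
    have "(\<Sum>l\<le>?d. u l *s ?T l) = (\<Sum>l\<in>{i, j}. u l *s ?T l)"
      using ij by (intro sum.mono_neutral_right) (auto simp: u_def)
    also have "\<dots> = 0" using ij by (simp add: u_def)
    finally show ?thesis using ij by (intro exI[of _ u]) (auto simp: u_def)
  qed
  then obtain u i where i: "i \<le> ?d" "u i \<noteq> 0" and sum0: "(\<Sum>i\<le>?d. u i *s ?T i) = 0"
    by blast
  define p where "p = (\<Sum>i\<le>?d. monom (u i) i)"
  have coeff: "coeff p l = (if l \<le> ?d then u l else 0)" for l
    by (simp add: p_def coeff_sum)
  have "degree p \<le> ?d" by (rule degree_le) (simp add: coeff)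
  then have "poly_act p A v = 0" by (simp add: poly_act_eq coeff sum0)
  moreover have "p \<noteq> 0" using i coeff[of i] by auto
  ultimately show ?thesis by blast
qed

text \<open>Once the perturbation \<open>y\<close> stays below \<open>e (1 - r) / 2\<close>, the recursion pulls \<open>norm (x n)\<close>
  geometrically towards its fixed point \<open>e / 2\<close>.\<close>

lemma tendsto_zero_of_contracting_recursion:
  fixes x y :: "nat \<Rightarrow> 'a::real_normed_vector"
  assumes le: "\<And>n. norm (x (Suc n)) \<le> r * norm (x n) + norm (y n)"
    and r: "0 \<le> r" "r < 1" and y: "y \<longlonglongrightarrow> 0"
  shows "x \<longlonglongrightarrow> 0"
proof (rule LIMSEQ_I)
  fix e :: real assume e: "0 < e"
  then have "0 < e * (1 - r) / 2" using r by simp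
  from LIMSEQ_D[OF y this] obtain N where N: "\<And>n. n \<ge> N \<Longrightarrow> norm (y n) < e * (1 - r) / 2"
    by auto
  have bound: "norm (x (N + m)) \<le> r ^ m * norm (x N) + e / 2" for m
  proof (induction m)
    case 0
    then show ?case using e by simp
  next
    case (Suc m)
    have "norm (x (N + Suc m)) \<le> r * (r ^ m * norm (x N) + e / 2) + e * (1 - r) / 2"
      using le[of "N + m"] N[of "N + m"] mult_left_mono[OF Suc r(1)] by simp
    then show ?case by (simp add: field_simps)
  qed
  have "(\<lambda>m. r ^ m * norm (x N)) \<longlonglongrightarrow> 0 * norm (x N)"
    using r by (intro tendsto_mult LIMSEQ_power_zero tendsto_const) simp
  then have "(\<lambda>m. r ^ m * norm (x N)) \<longlonglongrightarrow> 0" by simp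
  from LIMSEQ_D[OF this, of "e / 2"] e obtain K where
    K: "\<And>m. m \<ge> K \<Longrightarrow> norm (r ^ m * norm (x N) - 0) < e / 2" by auto
  show "\<exists>K. \<forall>n\<ge>K. norm (x n - 0) < e"
  proof (intro exI allI impI)
    fix n assume "N + K \<le> n"
    then obtain m where "n = N + m" "K \<le> m" by (metis add_le_cancel_left le_Suc_ex le_add1 order_trans)
    then show "norm (x n - 0) < e" using bound[of m] K[of m] by simp
  qed
qed

lemma norm_vector_scale: "norm (c *s (v::complex^'d)) = norm c * norm v"
  by (simp add: norm_vec_def norm_mult L2_set_right_distrib)

text \<open>Induction on the degree of the annihilating polynomial, which splits over the complex numbers.
  Let \<open>a\<close> be a root and \<open>w = A v - a v\<close>. If \<open>|a| < 1\<close>, then \<open>w\<close> is annihilated by the quotient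
  polynomial, so \<open>A^n w \<rightarrow> 0\<close>, and \<open>A^(n+1) v = a A^n v + A^n w\<close> is a contracting recursion. Otherwise
  \<open>a\<close> is not an eigenvalue, \<open>A - a\<close> is injective, and the quotient polynomial already annihilates \<open>v\<close>.\<close>

lemma funpow_tendsto_zero_of_poly_act:
  fixes A :: "complex^'d^'d"
  assumes eig: "\<And>z v. v \<noteq> 0 \<Longrightarrow> A *v v = z *s v \<Longrightarrow> norm z < 1"
    and "p \<noteq> 0" "poly_act p A v = 0"
  shows "(\<lambda>n. ((*v) A ^^ n) v) \<longlonglongrightarrow> 0"
  using assms(2,3)
proof (induction "degree p" arbitrary: p v)
  case 0
  then obtain c where "p = [:c:]" "c \<noteq> 0" by (metis degree_eq_zeroE pCons_eq_0_iff)
  then have "v = 0" using 0 by (simp add: poly_act_def)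
  moreover have "((*v) A ^^ n) 0 = 0" for n by (induction n) simp_all
  ultimately show ?case by simp
next
  case (Suc m)
  then obtain a where "poly p a = 0"
    using fundamental_theorem_of_algebra[of p] constant_degree[of p] by auto
  then obtain q where p: "p = [:- a, 1:] * q"
    by (auto simp: poly_eq_0_iff_dvd)
  with Suc.prems have "q \<noteq> 0" by auto
  moreover from this have "degree p = degree [:- a, 1:] + degree q"
    unfolding p by (intro degree_mult_eq) auto
  ultimately have q: "q \<noteq> 0" "degree q = m" using Suc.hyps(2) by auto
  let ?w = "A *v v - a *s v"
  have "poly_act q A ?w = 0"
    using Suc.prems(2) by (simp only: p poly_act_linear_factor)
  then have w: "(\<lambda>n. ((*v) A ^^ n) ?w) \<longlonglongrightarrow> 0"
    using Suc.hyps(1)[of q ?w] q by simp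
  have step: "((*v) A ^^ Suc n) v = a *s ((*v) A ^^ n) v + ((*v) A ^^ n) ?w" for n
    by (simp add: funpow_matrix_vector_diff funpow_matrix_vector_scale funpow_swap1 del: funpow.simps)
       (simp add: funpow_swap1)
  show ?case
  proof (cases "norm a < 1")
    case True
    show ?thesis
    proof (rule tendsto_zero_of_contracting_recursion[OF _ _ True w])
      show "norm (((*v) A ^^ Suc n) v) \<le> norm a * norm (((*v) A ^^ n) v) + norm (((*v) A ^^ n) ?w)" for n
        unfolding step norm_vector_scale[symmetric] by (rule norm_triangle_ineq)
    qed simp
  next
    case False
    have "poly_act q A v = 0"
    proof (rule ccontr)
      assume ne: "poly_act q A v \<noteq> 0"
      have "A *v poly_act q A v - a *s poly_act q A v = poly_act q A ?w"
        by (simp add: poly_act_def vec.linear_sum vector_scalar_commute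
            funpow_matrix_vector_diff funpow_matrix_vector_scale
            funpow_swap1 sum_subtractf vec.scale_right_diff_distrib
            vec.scale_sum_right mult.commute)
      also have "\<dots> = 0"
        using Suc.prems(2) by (simp only: p poly_act_linear_factor)
      finally have "A *v poly_act q A v = a *s poly_act q A v" by simp
      with eig[OF ne] False show False by blast
    qed
    then show ?thesis using Suc.hyps(1)[of q v] q by simp
  qed
qed

definition complexify :: "real^'d^'d \<Rightarrow> complex^'d^'d" where
  "complexify A = (\<chi> i j. complex_of_real (A $ i $ j))"

lemma complexify_mult: "complexify (A ** B) = complexify A ** complexify B"
  by (simp add: complexify_def matrix_matrix_mult_def vec_eq_iff)

lemma complexify_mat_1: "complexify (mat 1) = mat 1"
  by (simp add: complexify_def mat_def vec_eq_iff)

text \<open>The eigenvalues of the inverse are the reciprocals of those of \<open>M\<close>.\<close>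

lemma expansive_inverse_eigenvalue:
  fixes M :: "real^'d^'d"
  assumes "invertible M" "expansive M" "v \<noteq> 0" "complexify (matrix_inv M) *v v = z *s v"
  shows "norm z < 1"
proof -
  have "complexify M ** complexify (matrix_inv M) = mat 1"
    using assms(1) by (simp add: matrix_inv_cancel complexify_mat_1 flip: complexify_mult)
  then have v: "v = z *s (complexify M *v v)"
    using assms(4) by (metis matrix_vector_mul_assoc matrix_vector_mul_lid vector_scalar_commute)
  have "z \<noteq> 0" using v assms(3) by auto
  then have "complexify M *v v = inverse z *s v"
    by (subst (2) v) simp
  with assms(2,3) have "1 < norm (inverse z)"
    by (auto simp: expansive_def complexify_def)
  then show ?thesis using \<open>z \<noteq> 0\<close> by (simp add: norm_inverse one_less_inverse_iff)
qed

lemma matrix_power_inv_tendsto_zero: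
  fixes M :: "real^'d^'d"
  assumes "invertible M" "expansive M"
  shows "(\<lambda>n. matrix_power (matrix_inv M) n *v x) \<longlonglongrightarrow> 0"
proof -
  let ?N = "complexify (matrix_inv M)"
  let ?c = "\<lambda>x::real^'d. (\<chi> i. complex_of_real (x $ i))"
  have c: "?c (A *v x) = complexify A *v ?c x" for A x
    by (simp add: complexify_def matrix_vector_mult_def vec_eq_iff)
  have pow: "?c (matrix_power (matrix_inv M) n *v x) = ((*v) ?N ^^ n) (?c x)" for n
  proof (induction n)
    case 0
    then show ?case by (simp add: matrix_power_0)
  next
    case (Suc n)
    have "matrix_power (matrix_inv M) (Suc n) *v x = matrix_inv M *v (matrix_power (matrix_inv M) n *v x)"
      by (simp add: matrix_power_Suc matrix_vector_mul_assoc)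
    then show ?case by (simp only: c[of "matrix_inv M"] Suc funpow.simps o_apply)
  qed
  obtain p where "p \<noteq> 0" "poly_act p ?N (?c x) = 0" using ex_annihilating_poly by blast
  then have "(\<lambda>n. ((*v) ?N ^^ n) (?c x)) \<longlonglongrightarrow> 0"
    by (rule funpow_tendsto_zero_of_poly_act[rotated]) (rule expansive_inverse_eigenvalue[OF assms])
  then have "(\<lambda>n. ?c (matrix_power (matrix_inv M) n *v x)) \<longlonglongrightarrow> 0" by (simp only: pow)
  then have "(\<lambda>n. complex_of_real ((matrix_power (matrix_inv M) n *v x) $ i)) \<longlonglongrightarrow> 0" for i
    by (drule_tac tendsto_vec_nth[where i = i]) simp
  then have "(\<lambda>n. (matrix_power (matrix_inv M) n *v x) $ i) \<longlonglongrightarrow> 0" for i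
    by (metis of_real_0 tendsto_of_real_iff)
  then show ?thesis by (intro vec_tendstoI) simp
qed

text \<open>Convergence on the finitely many basis vectors gives uniform convergence on bounded sets.\<close>

lemma matrix_power_inv_small_on_ball:
  fixes M :: "real^'d^'d"
  assumes "invertible M" "expansive M" "0 < e" "0 \<le> R"
  shows "\<forall>\<^sub>F n in sequentially. \<forall>x. norm x \<le> R \<longrightarrow> norm (matrix_power (matrix_inv M) n *v x) < e"
proof -
  let ?P = "\<lambda>n. matrix_power (matrix_inv M) n"
  have "(\<lambda>n. R * (\<Sum>i\<in>UNIV. norm (?P n *v axis i 1))) \<longlonglongrightarrow> R * (\<Sum>i\<in>(UNIV::'d set). norm (0::real^'d))"
    by (intro tendsto_intros matrix_power_inv_tendsto_zero assms)
  then have "\<forall>\<^sub>F n in sequentially. R * (\<Sum>i\<in>UNIV. norm (?P n *v axis i 1)) < e"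
    using assms(3) by (intro order_tendstoD) auto
  then show ?thesis
  proof eventually_elim
    case (elim n)
    show ?case
    proof (intro allI impI)
      fix x :: "real^'d" assume x: "norm x \<le> R"
      have "?P n *v x = ?P n *v (\<Sum>i\<in>UNIV. x $ i *\<^sub>R axis i 1)"
        by (simp add: basis_expansion scalar_mult_eq_scaleR[symmetric])
      also have "\<dots> = (\<Sum>i\<in>UNIV. x $ i *\<^sub>R (?P n *v axis i 1))"
        by (simp add: linear_sum[OF matrix_vector_mul_linear] linear_scale[OF matrix_vector_mul_linear])
      also have "norm \<dots> \<le> (\<Sum>i\<in>UNIV. R * norm (?P n *v axis i 1))"
      proof (rule sum_norm_le)
        show "norm (x $ i *\<^sub>R (?P n *v axis i 1)) \<le> R * norm (?P n *v axis i 1)" for i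
          using x component_le_norm_cart[of x i] by (auto intro!: mult_right_mono)
      qed
      also have "\<dots> < e" using elim by (simp add: sum_distrib_left)
      finally show "norm (?P n *v x) < e" .
    qed
  qed
qed

section \<open>Linear change of variables\<close>

text \<open>Moves one corner of the box to the origin, where the volume of a sheared box is easiest to compute.\<close>

lemma translate_cbox_image:
  fixes A :: "real^'n^'n"
  shows "(*v) A ` cbox a b = (+) (A *v a) ` (*v) A ` cbox 0 (b - a)"
proof -
  have "cbox a b = (+) a ` cbox 0 (b - a)"
    using cbox_translation[of a 0 "b - a"] by simp
  then show ?thesis
    by (simp add: image_image matrix_vector_right_distrib)
qed

text \<open>A linear map scales volume by the absolute value of its determinant. Both
  sides are multiplicative in the matrix, so it suffices to treat generators of the matrix monoid:
  singular matrices, diagonal matrices, transpositions and shears. For the last two,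
  comparing the volumes of boxes is enough, and the determinant has absolute value one.\<close>

lemma
  fixes A :: "real^'n^'n"
  assumes "S \<in> lmeasurable"
  shows matrix_image_lmeasurable: "(*v) A ` S \<in> lmeasurable"
    and measure_matrix_image: "measure lebesgue ((*v) A ` S) = \<bar>det A\<bar> * measure lebesgue S"
proof -
  have "\<forall>S\<in>lmeasurable. (*v) A ` S \<in> lmeasurable \<and>
      measure lebesgue ((*v) A ` S) = \<bar>det A\<bar> * measure lebesgue S"
  proof (induction A rule: induct_matrix_elementary_alt)
    case (1 A B)
    have "(*v) (A ** B) ` S = (*v) A ` (*v) B ` S" for S
      by (simp add: image_image matrix_vector_mul_assoc)
    then show ?case using 1 by (simp add: det_mul abs_mult)
  next
    case (2 A i)
    then have det: "det A = 0" by (simp add: det_zero_row)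
    then have "\<not> inj ((*v) A)"
      using det_nz_iff_inj[OF matrix_vector_mul_linear[of A]] by simp
    then have "negligible ((*v) A ` S)" for S
      by (intro negligible_linear_singular_image) (auto simp: matrix_vector_mul_linear)
    then show ?case
      by (simp add: det negligible_iff_measure)
  next
    case (3 A)
    have "(\<Sum>j\<in>UNIV. A $ i $ j * x $ j) = A $ i $ i * x $ i" for x :: "real^'n" and i
      using 3 by (subst sum.remove[of _ i]) auto
    then have "A *v x = (\<chi> k. A $ k $ k * x $ k)" for x
      by (simp add: vec_eq_iff matrix_vector_mult_def)
    then have "(*v) A = (\<lambda>x. \<chi> k. A $ k $ k * x $ k)" by (rule ext)
    moreover have "det A = (\<Prod>k\<in>UNIV. A $ k $ k)" using 3 by (rule det_diagonal)
    ultimately show ?case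
      by (simp add: measurable_stretch measure_stretch)
  next
    case (4 m n)
    let ?A = "(\<chi> i j. mat 1 $ i $ Transposition.transpose m n j) :: real^'n^'n"
    have A: "?A *v x = (\<chi> i. x $ Transposition.transpose m n i)" for x
    proof -
      have "(\<Sum>j\<in>UNIV. mat 1 $ i $ Transposition.transpose m n j * x $ j)
          = (\<Sum>j\<in>UNIV. if j = Transposition.transpose m n i then x $ j else 0)" for i
        by (intro sum.cong refl) (auto simp: mat_def)
      then show ?thesis by (simp add: vec_eq_iff matrix_vector_mult_def)
    qed
    have det: "\<bar>det ?A\<bar> = 1"
      using det_permute_columns[OF permutes_swap_id[of m UNIV n], of "mat 1 :: real^'n^'n"]
      by (simp add: sign_swap_id abs_mult)
    have "measure lebesgue ((*v) ?A ` cbox a b) = 1 * measure lebesgue (cbox a b)" for a b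
    proof (cases "cbox a b = {}")
      case False
      have "(*v) ?A ` cbox a b = cbox (?A *v a) (?A *v b)"
      proof (intro set_eqI iffI)
        fix y assume "y \<in> cbox (?A *v a) (?A *v b)"
        then have "?A *v y \<in> cbox a b"
          unfolding A mem_box_cart vec_lambda_beta
          by (auto dest: spec[where x = "Transposition.transpose m n i" for i])
        moreover have "y = ?A *v (?A *v y)" unfolding A by (simp add: vec_eq_iff)
        ultimately show "y \<in> (*v) ?A ` cbox a b" by (rule image_eqI[rotated])
      qed (auto simp: A mem_box_cart)
      moreover have "cbox (?A *v a) (?A *v b) \<noteq> {}"
        unfolding calculation[symmetric] using False by simp
      moreover have "(\<Prod>i\<in>UNIV. b $ Transposition.transpose m n i - a $ Transposition.transpose m n i)
          = (\<Prod>i\<in>UNIV. b $ i - a $ i)"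
        by (rule prod.reindex_bij_betw[where g = "\<lambda>i. b $ i - a $ i"]) (rule bij_transpose)
      ultimately show ?thesis using False
        by (simp add: content_cbox_cart A)
    qed simp
    then have *: "(*v) ?A ` S \<in> lmeasurable \<and> 1 * measure lebesgue S = measure lebesgue ((*v) ?A ` S)"
      if "S \<in> lmeasurable" for S
      using that by (intro measure_linear_sufficient matrix_vector_mul_linear)
    show ?case
      unfolding det by (intro ballI conjI *[THEN conjunct1] *[THEN conjunct2, symmetric])
  next
    case (5 m n)
    let ?A = "(\<chi> i j. of_bool (i = m \<and> j = n \<or> i = j)) :: real^'n^'n"
    have A: "?A *v x = (\<chi> i. if i = m then x $ m + x $ n else x $ i)" for x
    proof -
      have "(\<Sum>j\<in>UNIV. of_bool (i = m \<and> j = n \<or> i = j) * x $ j)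
          = (\<Sum>j\<in>UNIV. (if j = n then if i = m then x $ j else 0 else 0) + (if j = i then x $ j else 0))" for i
        using 5 by (intro sum.cong) auto
      then show ?thesis by (simp add: vec_eq_iff matrix_vector_mult_def sum.distrib)
    qed
    \<comment> \<open>A shear arises from the identity by adding row \<open>n\<close> to row \<open>m\<close>.\<close>
    have "det ?A = det (\<chi> k. if k = m then row m (mat 1 :: real^'n^'n) + 1 *s row n (mat 1) else row k (mat 1))"
      using 5 by (intro arg_cong[where f = det]) (auto simp: vec_eq_iff row_def mat_def)
    also have "\<dots> = 1" using 5 by (subst det_row_operation) auto
    finally have det: "det ?A = 1" .
    have "measure lebesgue ((*v) ?A ` cbox a b) = 1 * measure lebesgue (cbox a b)" for a b
    proof (cases "cbox a b = {}")
      case False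
      have cb: "cbox a b = (+) a ` cbox 0 (b - a)"
        using cbox_translation[of a 0 "b - a"] by simp
      have "measure lebesgue ((*v) ?A ` cbox 0 (b - a)) = measure lebesgue (cbox 0 (b - a))"
        unfolding A using 5 False cb by (intro measure_shear_interval) auto
      then show ?thesis
        unfolding translate_cbox_image[of ?A a b] measure_translation
        by (subst cb) (simp only: measure_translation mult_1)
    qed simp
    then have *: "(*v) ?A ` S \<in> lmeasurable \<and> 1 * measure lebesgue S = measure lebesgue ((*v) ?A ` S)"
      if "S \<in> lmeasurable" for S
      using that by (intro measure_linear_sufficient matrix_vector_mul_linear)
    show ?case
      unfolding det abs_one by (intro ballI conjI *[THEN conjunct1] *[THEN conjunct2, symmetric])
  qed
  with assms show "(*v) A ` S \<in> lmeasurable" "measure lebesgue ((*v) A ` S) = \<bar>det A\<bar> * measure lebesgue S"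
    by auto
qed

lemma emeasure_eq_top_of_not_fmeasurable:
  assumes "S \<in> sets N" "S \<notin> fmeasurable N"
  shows "emeasure N S = \<infinity>"
proof (rule ccontr)
  assume "emeasure N S \<noteq> \<infinity>"
  then have "emeasure N S < \<infinity>" by (simp add: less_top)
  with assms show False by (blast intro: fmeasurableI)
qed

lemma emeasure_matrix_image:
  fixes A :: "real^'n^'n"
  assumes A: "invertible A" and S: "S \<in> sets lebesgue"
  shows "(*v) A ` S \<in> sets lebesgue"
    and "emeasure lebesgue ((*v) A ` S) = ennreal \<bar>det A\<bar> * emeasure lebesgue S"
proof -
  show im: "(*v) A ` S \<in> sets lebesgue"
    using S by (rule differentiable_image_in_sets_lebesgue)
      (auto intro!: linear_imp_differentiable_on matrix_vector_mul_linear)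
  have S_eq: "S = (*v) (matrix_inv A) ` (*v) A ` S"
    by (simp add: image_image matrix_vector_mul_assoc matrix_inv_cancel[OF A])
  show "emeasure lebesgue ((*v) A ` S) = ennreal \<bar>det A\<bar> * emeasure lebesgue S"
  \<comment> \<open>A set of infinite measure has an image of infinite measure, as the inverse matrix maps it back.\<close>
  proof (cases "S \<in> lmeasurable")
    case True
    then show ?thesis
      using matrix_image_lmeasurable[OF True, of A] measure_matrix_image[OF True, of A]
      by (simp add: emeasure_eq_measure2 ennreal_mult)
  next
    case False
    from S this have "emeasure lebesgue S = \<infinity>"
      by (rule emeasure_eq_top_of_not_fmeasurable)
    moreover have "(*v) A ` S \<notin> lmeasurable"
      using False S_eq matrix_image_lmeasurable by metis
    with im have "emeasure lebesgue ((*v) A ` S) = \<infinity>"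
      by (rule emeasure_eq_top_of_not_fmeasurable)
    moreover have "\<bar>det A\<bar> > 0" using A by (simp add: invertible_det_nz)
    ultimately show ?thesis by (simp add: ennreal_mult_top)
  qed
qed

text \<open>As an identity of measures, the scaling of volumes yields the substitution rule for nonnegative
  and for vector-valued integrals at once.\<close>

lemma
  fixes U :: "real^'n^'n"
  assumes U: "invertible U"
  shows measurable_matrix_affine: "(\<lambda>x. U *v x - k) \<in> lebesgue \<rightarrow>\<^sub>M lebesgue"
    and distr_matrix_affine:
      "distr lebesgue lebesgue (\<lambda>x. U *v x - k) = density lebesgue (\<lambda>_. ennreal (1 / \<bar>det U\<bar>))"
proof -
  let ?T = "\<lambda>x. U *v x - k" and ?V = "matrix_inv U"
  have V: "invertible ?V" by (rule invertible_matrix_inv[OF U])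
  have "det U * det ?V = 1" by (simp add: matrix_inv_cancel[OF U] flip: det_mul)
  then have det: "\<bar>det ?V\<bar> = 1 / \<bar>det U\<bar>"
    by (metis abs_mult abs_one nonzero_eq_divide_eq mult.commute mult_zero_right zero_neq_one)
  have vim: "?T -` S = (*v) ?V ` (+) k ` S" for S
  proof (intro set_eqI iffI)
    fix x assume "x \<in> ?T -` S"
    then show "x \<in> (*v) ?V ` (+) k ` S"
      by (intro image_eqI[where x = "U *v x"] image_eqI[where x = "U *v x - k"])
         (auto simp: matrix_vector_mul_assoc matrix_inv_cancel[OF U])
  qed (auto simp: matrix_vector_mul_assoc matrix_inv_cancel[OF U])
  show meas: "?T \<in> lebesgue \<rightarrow>\<^sub>M lebesgue"
    using V by (intro measurableI) (auto simp: vim lebesgue_sets_translation intro: emeasure_matrix_image)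
  show "distr lebesgue lebesgue ?T = density lebesgue (\<lambda>_. ennreal (1 / \<bar>det U\<bar>))"
  proof (rule measure_eqI)
    fix S assume "S \<in> sets (distr lebesgue lebesgue ?T)"
    then have S: "S \<in> sets lebesgue" by simp
    have "emeasure lebesgue (?T -` S) = ennreal \<bar>det ?V\<bar> * emeasure lebesgue ((+) k ` S)"
      unfolding vim by (rule emeasure_matrix_image[OF V lebesgue_sets_translation[OF S]])
    also have "emeasure lebesgue ((+) k ` S) = emeasure lebesgue S"
      using emeasure_lebesgue_affine[of 1 k S] by (simp add: add.commute)
    finally show "emeasure (distr lebesgue lebesgue ?T) S = emeasure (density lebesgue (\<lambda>_. ennreal (1 / \<bar>det U\<bar>))) S"
      using S meas by (simp add: emeasure_distr emeasure_density nn_integral_cmult_indicator det)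
  qed simp
qed

lemma nn_integral_matrix_affine:
  fixes U :: "real^'n^'n"
  assumes U: "invertible U" and f: "f \<in> borel_measurable lebesgue"
  shows "(\<integral>\<^sup>+x. f (U *v x - k) \<partial>lebesgue) = ennreal (1 / \<bar>det U\<bar>) * (\<integral>\<^sup>+x. f x \<partial>lebesgue)"
proof -
  have "(\<integral>\<^sup>+x. f (U *v x - k) \<partial>lebesgue) = (\<integral>\<^sup>+x. f x \<partial>distr lebesgue lebesgue (\<lambda>x. U *v x - k))"
    by (intro nn_integral_distr[symmetric] measurable_matrix_affine U) (use f in simp)
  also have "\<dots> = ennreal (1 / \<bar>det U\<bar>) * (\<integral>\<^sup>+x. f x \<partial>lebesgue)"
    unfolding distr_matrix_affine[OF U] using f
    by (simp add: nn_integral_density nn_integral_cmult)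
  finally show ?thesis .
qed

lemma integral_matrix_affine:
  fixes U :: "real^'n^'n" and f :: "real^'n \<Rightarrow> 'b::{banach, second_countable_topology}"
  assumes U: "invertible U" and f: "f \<in> borel_measurable lebesgue"
  shows "(LINT x|lebesgue. f (U *v x - k)) = (LINT x|lebesgue. f x) /\<^sub>R \<bar>det U\<bar>"
proof -
  have "(LINT x|lebesgue. f (U *v x - k)) = (LINT x|distr lebesgue lebesgue (\<lambda>x. U *v x - k). f x)"
    by (intro integral_distr[symmetric] measurable_matrix_affine U f)
  also have "\<dots> = (LINT x|lebesgue. f x) /\<^sub>R \<bar>det U\<bar>"
    unfolding distr_matrix_affine[OF U] using f
    by (simp add: integral_density inverse_eq_divide)
  finally show ?thesis .
qed

section \<open>Square-integrable functions and dilations\<close>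

text \<open>The squared norm as an extended real, so that no integrability has to be checked before it is
  computed.\<close>

definition energy :: "(real^'d \<Rightarrow> complex) \<Rightarrow> ennreal" where
  "energy f = (\<integral>\<^sup>+x. ennreal ((cmod (f x))\<^sup>2) \<partial>lebesgue)"

lemma L2_measurable: "f \<in> L2 \<Longrightarrow> f \<in> borel_measurable lebesgue"
  by (simp add: L2_def)

lemma L2_iff_energy: "f \<in> L2 \<longleftrightarrow> f \<in> borel_measurable lebesgue \<and> energy f < \<infinity>"
  by (auto simp: L2_def energy_def integrable_iff_bounded)

lemma L2_norm_eq_energy: "f \<in> L2 \<Longrightarrow> ennreal ((L2_norm f)\<^sup>2) = energy f"
  by (simp add: L2_def energy_def L2_norm_def nn_integral_eq_integral)

lemma cmod_add_squared_le: "(cmod (a + b))\<^sup>2 \<le> 2 * (cmod a)\<^sup>2 + 2 * (cmod b)\<^sup>2"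
proof -
  have "(cmod (a + b))\<^sup>2 \<le> (cmod a + cmod b)\<^sup>2"
    by (intro power_mono norm_triangle_ineq) simp
  also have "\<dots> \<le> 2 * (cmod a)\<^sup>2 + 2 * (cmod b)\<^sup>2"
    using zero_le_power2[of "cmod a - cmod b"] by (simp add: power2_eq_square algebra_simps)
  finally show ?thesis .
qed

lemma L2_diff:
  assumes "f \<in> L2" "g \<in> L2"
  shows "(\<lambda>x. f x - g x) \<in> L2"
proof -
  note [measurable] = L2_measurable[OF assms(1)] L2_measurable[OF assms(2)]
  have "integrable lebesgue (\<lambda>x. (cmod (f x - g x))\<^sup>2)"
  proof (rule Bochner_Integration.integrable_bound)
    show "integrable lebesgue (\<lambda>x. 2 * (cmod (f x))\<^sup>2 + 2 * (cmod (g x))\<^sup>2)"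
      using assms by (simp add: L2_def)
    show "AE x in lebesgue. norm ((cmod (f x - g x))\<^sup>2) \<le> norm (2 * (cmod (f x))\<^sup>2 + 2 * (cmod (g x))\<^sup>2)"
      using cmod_add_squared_le[of "f x" "- g x" for x] by simp
  qed measurable
  then show ?thesis by (simp add: L2_def)
qed

lemma L2_mult_integrable:
  assumes "f \<in> L2" "g \<in> L2"
  shows "integrable lebesgue (\<lambda>x. f x * cnj (g x))"
proof (rule Bochner_Integration.integrable_bound)
  show "integrable lebesgue (\<lambda>x. (cmod (f x))\<^sup>2 + (cmod (g x))\<^sup>2)"
    using assms by (simp add: L2_def)
  have cnj: "(\<lambda>x. cnj (g x)) \<in> borel_measurable lebesgue"
    using measurable_compose[OF L2_measurable[OF assms(2)] borel_measurable_continuous_onI[of cnj]]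
    by (simp add: continuous_on_cnj)
  show "(\<lambda>x. f x * cnj (g x)) \<in> borel_measurable lebesgue"
    using L2_measurable[OF assms(1)] cnj by (rule borel_measurable_times)
  have "cmod a * cmod b \<le> (cmod a)\<^sup>2 + (cmod b)\<^sup>2" for a b
    using zero_le_power2[of "cmod a - cmod b"] mult_nonneg_nonneg[OF norm_ge_zero[of a] norm_ge_zero[of b]]
    by (simp only: power2_eq_square algebra_simps)
  then show "AE x in lebesgue. norm (f x * cnj (g x)) \<le> norm ((cmod (f x))\<^sup>2 + (cmod (g x))\<^sup>2)"
    by (simp add: norm_mult)
qed

lemma energy_dilate_shift:
  assumes "invertible U" "f \<in> borel_measurable lebesgue"
  shows "energy (dilate_shift U k f) = energy f"
proof -
  have U0: "det U \<noteq> 0" using assms(1) by (simp add: invertible_det_nz)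
  have F: "(\<lambda>y. ennreal (\<bar>det U\<bar> * (cmod (f y))\<^sup>2)) \<in> borel_measurable lebesgue"
    using assms(2) by measurable
  have "energy (dilate_shift U k f) = (\<integral>\<^sup>+x. ennreal (\<bar>det U\<bar> * (cmod (f (U *v x - k)))\<^sup>2) \<partial>lebesgue)"
    by (simp add: energy_def dilate_shift_def norm_mult power_mult_distrib)
  also have "\<dots> = ennreal (1 / \<bar>det U\<bar>) * (\<integral>\<^sup>+x. ennreal (\<bar>det U\<bar> * (cmod (f x))\<^sup>2) \<partial>lebesgue)"
    by (rule nn_integral_matrix_affine[OF assms(1) F])
  also have "\<dots> = (\<integral>\<^sup>+x. ennreal (1 / \<bar>det U\<bar>) * ennreal (\<bar>det U\<bar> * (cmod (f x))\<^sup>2) \<partial>lebesgue)"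
    using F by (rule nn_integral_cmult[symmetric])
  also have "\<dots> = energy f"
    unfolding energy_def using U0 by (intro nn_integral_cong) (simp flip: ennreal_mult)
  finally show ?thesis .
qed

lemma measurable_dilate_shift:
  assumes "invertible U" "f \<in> borel_measurable lebesgue"
  shows "dilate_shift U k f \<in> borel_measurable lebesgue"
  unfolding dilate_shift_def
  by (intro borel_measurable_times borel_measurable_const measurable_compose[OF measurable_matrix_affine[OF assms(1)] assms(2)])

lemma dilate_shift_L2:
  assumes "invertible U" "f \<in> L2"
  shows "dilate_shift U k f \<in> L2"
  using assms by (simp add: L2_iff_energy energy_dilate_shift measurable_dilate_shift)

lemma L2_inner_add_left:
  assumes "f \<in> L2" "g \<in> L2" "h \<in> L2"
  shows "L2_inner (\<lambda>x. f x + g x) h = L2_inner f h + L2_inner g h"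
  using assms by (simp add: L2_inner_def distrib_right L2_mult_integrable)

text \<open>The substitution \<open>y = U x\<close>: the two normalising factors contribute
  \<open>sqrt |det U| * sqrt |det U|\<close>, which the Jacobian cancels.\<close>

lemma L2_inner_dilate:
  assumes U: "invertible U" and V: "invertible V" and f: "f \<in> L2" and g: "g \<in> L2"
  shows "L2_inner (dilate_shift U 0 f) (dilate_shift (V ** U) k g) = L2_inner f (dilate_shift V k g)"
proof -
  let ?h = "\<lambda>y. f y * cnj (dilate_shift V k g y)"
  have U0: "det U \<noteq> 0" using U by (simp add: invertible_det_nz)
  have h: "?h \<in> borel_measurable lebesgue"
    using L2_mult_integrable[OF f dilate_shift_L2[OF V g]] by (rule borel_measurable_integrable)
  have "complex_of_real (sqrt \<bar>det U\<bar>) * complex_of_real (sqrt \<bar>det U\<bar>) = complex_of_real \<bar>det U\<bar>"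
    by (simp flip: of_real_mult)
  then have "dilate_shift U 0 f x * cnj (dilate_shift (V ** U) k g x) = complex_of_real \<bar>det U\<bar> * ?h (U *v x - 0)" for x
    by (simp add: dilate_shift_def det_mul abs_mult real_sqrt_mult matrix_vector_mul_assoc mult_ac)
  then have "L2_inner (dilate_shift U 0 f) (dilate_shift (V ** U) k g)
      = complex_of_real \<bar>det U\<bar> * (LINT x|lebesgue. ?h (U *v x - 0))"
    unfolding L2_inner_def by (simp only: integral_mult_right_zero)
  also have "\<dots> = L2_inner f (dilate_shift V k g)"
    unfolding integral_matrix_affine[OF U h] using U0 by (simp add: L2_inner_def scaleR_conv_of_real)
  finally show ?thesis .
qed

text \<open>The inner product with a function supported in \<open>S\<close> only depends on the other factor inside \<open>S\<close>.\<close>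

lemma L2_inner_Cauchy_Schwarz_on:
  assumes f: "f \<in> L2" and g: "g \<in> L2" and S: "S \<in> sets lebesgue" and supp: "\<And>x. x \<notin> S \<Longrightarrow> f x = 0"
  shows "ennreal ((cmod (L2_inner f g))\<^sup>2) \<le> energy f * (\<integral>\<^sup>+x. indicator S x * ennreal ((cmod (g x))\<^sup>2) \<partial>lebesgue)"
proof -
  note [measurable] = L2_measurable[OF f] L2_measurable[OF g] S
  have "ennreal (cmod (L2_inner f g)) \<le> (\<integral>\<^sup>+x. ennreal (cmod (f x * cnj (g x))) \<partial>lebesgue)"
    unfolding L2_inner_def by (rule integral_norm_bound_ennreal[OF L2_mult_integrable[OF f g]])
  also have "\<dots> = (\<integral>\<^sup>+x. ennreal (cmod (f x)) * (indicator S x * ennreal (cmod (g x))) \<partial>lebesgue)"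
    using supp by (intro nn_integral_cong) (auto simp: norm_mult ennreal_mult split: split_indicator)
  finally have "(ennreal (cmod (L2_inner f g)))\<^sup>2
      \<le> (\<integral>\<^sup>+x. ennreal (cmod (f x)) * (indicator S x * ennreal (cmod (g x))) \<partial>lebesgue)\<^sup>2"
    by (intro power_mono) auto
  also have "\<dots> \<le> (\<integral>\<^sup>+x. (ennreal (cmod (f x)))\<^sup>2 \<partial>lebesgue) * (\<integral>\<^sup>+x. (indicator S x * ennreal (cmod (g x)))\<^sup>2 \<partial>lebesgue)"
    by (rule Cauchy_Schwarz_nn_integral) measurable
  also have "(\<integral>\<^sup>+x. (indicator S x * ennreal (cmod (g x)))\<^sup>2 \<partial>lebesgue)
      = (\<integral>\<^sup>+x. indicator S x * ennreal ((cmod (g x))\<^sup>2) \<partial>lebesgue)"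
    by (intro nn_integral_cong) (auto simp: ennreal_power split: split_indicator)
  also have "(\<integral>\<^sup>+x. (ennreal (cmod (f x)))\<^sup>2 \<partial>lebesgue) = energy f"
    by (simp add: energy_def ennreal_power)
  finally show ?thesis by (simp add: ennreal_power)
qed

section \<open>Changing the level of a nonhomogeneous system\<close>

text \<open>Moving the dilation from \<open>f\<close> to the generators shifts the level by \<open>n\<close>, because the dilation
  matrices of levels \<open>j + n\<close> and \<open>j\<close> differ by the factor \<open>M^n\<close> on the right.\<close>

lemma level_sum_dilate:
  assumes M: "invertible M" and f: "f \<in> L2" and \<phi>: "\<And>a. a \<in> A \<Longrightarrow> \<phi> a \<in> L2"
  shows "level_sum M (j + n) A \<phi> (dilate_shift (matrix_powi M n) 0 f) = level_sum M j A \<phi> f"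
  unfolding level_sum_def matrix_powi_add[OF M]
  by (intro infsum_cong arg_cong[where f = ennreal] arg_cong[where f = "\<lambda>z. (cmod z)\<^sup>2"]
      L2_inner_dilate invertible_matrix_powi M f \<phi>)

lemma nonhomogeneous_sum_dilate:
  assumes M: "invertible M" and f: "f \<in> L2"
    and \<phi>: "\<And>a. a \<in> A \<Longrightarrow> \<phi> a \<in> L2" and \<psi>: "\<And>b. b \<in> B \<Longrightarrow> \<psi> b \<in> L2"
  defines "g \<equiv> \<lambda>n. dilate_shift (matrix_powi M n) 0 f"
  shows "level_sum M (J + n) A \<phi> (g n) + (\<Sum>\<^sub>\<infinity>j\<in>{J + n..}. level_sum M j B \<psi> (g n))
    = level_sum M J A \<phi> f + (\<Sum>\<^sub>\<infinity>j\<in>{J..}. level_sum M j B \<psi> f)"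
proof -
  have "bij_betw (\<lambda>j. j + n) {J..} {J + n..}"
    by (rule bij_betwI[where g = "\<lambda>j. j - n"]) auto
  then have "(\<Sum>\<^sub>\<infinity>j\<in>{J + n..}. level_sum M j B \<psi> (g n)) = (\<Sum>\<^sub>\<infinity>j\<in>{J..}. level_sum M (j + n) B \<psi> (g n))"
    by (rule infsum_reindex_bij_betw[symmetric])
  then show ?thesis
    by (simp add: g_def level_sum_dilate[OF M f \<phi>] level_sum_dilate[OF M f \<psi>])
qed

lemma nonhomogeneous_wavelet_frame_all_levels:
  assumes M: "invertible M"
    and \<phi>: "\<And>a. a \<in> A \<Longrightarrow> \<phi> a \<in> L2" and \<psi>: "\<And>b. b \<in> B \<Longrightarrow> \<psi> b \<in> L2"
    and frame: "nonhomogeneous_wavelet_frame M J\<^sub>0 A \<phi> B \<psi> C\<^sub>1 C\<^sub>2"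
  shows "nonhomogeneous_wavelet_frame M J A \<phi> B \<psi> C\<^sub>1 C\<^sub>2"
proof -
  have "ennreal (C\<^sub>1 * (L2_norm f)\<^sup>2) \<le> level_sum M J A \<phi> f + (\<Sum>\<^sub>\<infinity>j\<in>{J..}. level_sum M j B \<psi> f) \<and>
        level_sum M J A \<phi> f + (\<Sum>\<^sub>\<infinity>j\<in>{J..}. level_sum M j B \<psi> f) \<le> ennreal (C\<^sub>2 * (L2_norm f)\<^sup>2)"
    if f: "f \<in> L2" for f
  proof -
    define g where "g = dilate_shift (matrix_powi M (J\<^sub>0 - J)) 0 f"
    have g: "g \<in> L2" unfolding g_def by (intro dilate_shift_L2 invertible_matrix_powi M f)
    have "energy g = energy f"
      unfolding g_def by (intro energy_dilate_shift invertible_matrix_powi M L2_measurable f)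
    then have "(L2_norm g)\<^sup>2 = (L2_norm f)\<^sup>2"
      by (simp flip: L2_norm_eq_energy[OF f] L2_norm_eq_energy[OF g])
    moreover have "level_sum M J\<^sub>0 A \<phi> g + (\<Sum>\<^sub>\<infinity>j\<in>{J\<^sub>0..}. level_sum M j B \<psi> g)
        = level_sum M J A \<phi> f + (\<Sum>\<^sub>\<infinity>j\<in>{J..}. level_sum M j B \<psi> f)"
      using nonhomogeneous_sum_dilate[OF M f, where \<phi> = \<phi> and A = A and \<psi> = \<psi> and B = B and J = J
          and n = "J\<^sub>0 - J"] \<phi> \<psi>
      by (simp add: g_def)
    ultimately show ?thesis
      using frame g by (auto simp: nonhomogeneous_wavelet_frame_def)
  qed
  then show ?thesis using frame by (auto simp: nonhomogeneous_wavelet_frame_def)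
qed

section \<open>Unordered sums and quasi-additivity of the level sums\<close>

lemma ennreal_family_summable [simp]: "(f :: 'a \<Rightarrow> ennreal) summable_on A"
  by (rule nonneg_summable_on_complete) simp

lemma finite_sum_le_infsum_ennreal:
  fixes f :: "'a \<Rightarrow> ennreal"
  assumes "finite F" "F \<subseteq> A"
  shows "sum f F \<le> (\<Sum>\<^sub>\<infinity>a\<in>A. f a)"
  using infsum_mono_neutral[of f F f A] assms by auto

lemma infsum_cmult_ennreal_le:
  fixes f :: "'a \<Rightarrow> ennreal"
  shows "(\<Sum>\<^sub>\<infinity>a\<in>A. c * f a) \<le> c * (\<Sum>\<^sub>\<infinity>a\<in>A. f a)"
proof (rule infsum_le_finite_sums)
  fix F assume "finite F" "F \<subseteq> A"
  then have "sum f F \<le> (\<Sum>\<^sub>\<infinity>a\<in>A. f a)"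
    by (rule finite_sum_le_infsum_ennreal)
  then show "(\<Sum>a\<in>F. c * f a) \<le> c * (\<Sum>\<^sub>\<infinity>a\<in>A. f a)"
    by (simp add: mult_left_mono flip: sum_distrib_left)
qed simp

lemma infsum_le_nn_integral_count_space:
  fixes f :: "'a \<Rightarrow> ennreal"
  shows "(\<Sum>\<^sub>\<infinity>a\<in>A. f a) \<le> (\<integral>\<^sup>+a. f a \<partial>count_space A)"
proof (rule infsum_le_finite_sums)
  fix F assume F: "finite F" "F \<subseteq> A"
  then have "sum f F = (\<integral>\<^sup>+a. f a \<partial>count_space F)"
    by (simp add: nn_integral_count_space_finite)
  also have "\<dots> \<le> (\<integral>\<^sup>+a. f a \<partial>count_space A)"
    using F by (auto simp: nn_integral_count_space_indicator intro!: nn_integral_mono split: split_indicator)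
  finally show "sum f F \<le> (\<integral>\<^sup>+a. f a \<partial>count_space A)" .
qed simp

lemma infsum_quasi_add_ennreal:
  fixes f g h :: "'a \<Rightarrow> ennreal"
  assumes "\<And>a. a \<in> A \<Longrightarrow> h a \<le> 2 * f a + 2 * g a"
  shows "(\<Sum>\<^sub>\<infinity>a\<in>A. h a) \<le> 2 * (\<Sum>\<^sub>\<infinity>a\<in>A. f a) + 2 * (\<Sum>\<^sub>\<infinity>a\<in>A. g a)"
proof -
  have "(\<Sum>\<^sub>\<infinity>a\<in>A. h a) \<le> (\<Sum>\<^sub>\<infinity>a\<in>A. 2 * f a + 2 * g a)"
    using assms by (intro infsum_mono) auto
  also have "\<dots> = (\<Sum>\<^sub>\<infinity>a\<in>A. 2 * f a) + (\<Sum>\<^sub>\<infinity>a\<in>A. 2 * g a)"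
    by (intro infsum_add) auto
  also have "\<dots> \<le> 2 * (\<Sum>\<^sub>\<infinity>a\<in>A. f a) + 2 * (\<Sum>\<^sub>\<infinity>a\<in>A. g a)"
    by (intro add_mono infsum_cmult_ennreal_le)
  finally show ?thesis .
qed

text \<open>A crude replacement for the triangle inequality of the seminorm \<open>f \<mapsto> sqrt (level_sum M j A \<phi> f)\<close>:
  the factor 2 is harmless, since both terms on the right will be made arbitrarily small.\<close>

lemma level_sum_add_le:
  assumes M: "invertible M" and f: "f \<in> L2" and g: "g \<in> L2"
    and \<phi>: "\<And>a. a \<in> A \<Longrightarrow> \<phi> a \<in> L2"
  shows "level_sum M j A \<phi> (\<lambda>x. f x + g x) \<le> 2 * level_sum M j A \<phi> f + 2 * level_sum M j A \<phi> g"
  unfolding level_sum_def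
proof (intro infsum_quasi_add_ennreal)
  fix a k assume "a \<in> A"
  then have h: "dilate_shift (matrix_powi M j) k (\<phi> a) \<in> L2" (is "?h \<in> _")
    by (intro dilate_shift_L2 invertible_matrix_powi M \<phi>)
  have "ennreal ((cmod (L2_inner f ?h + L2_inner g ?h))\<^sup>2)
      \<le> ennreal (2 * (cmod (L2_inner f ?h))\<^sup>2 + 2 * (cmod (L2_inner g ?h))\<^sup>2)"
    by (intro ennreal_leI cmod_add_squared_le)
  then show "ennreal ((cmod (L2_inner (\<lambda>x. f x + g x) ?h))\<^sup>2)
      \<le> 2 * ennreal ((cmod (L2_inner f ?h))\<^sup>2) + 2 * ennreal ((cmod (L2_inner g ?h))\<^sup>2)"
    by (simp add: L2_inner_add_left[OF f g h] ennreal_plus ennreal_mult)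
qed

section \<open>Small neighbourhoods of the integer lattice\<close>

definition lattice_nbhd :: "real \<Rightarrow> (real^'d) set" where
  "lattice_nbhd e = (\<Union>k\<in>int_lattice. ball k e)"

lemma lattice_nbhd_sets: "lattice_nbhd e \<in> sets lebesgue"
  unfolding lattice_nbhd_def by (intro lebesgue_openin[where S=UNIV, simplified]) auto

lemma int_lattice_separated:
  fixes k l :: "real^'d"
  assumes "k \<in> int_lattice" "l \<in> int_lattice" "k \<noteq> l"
  shows "1 \<le> dist k l"
proof -
  obtain i where i: "k $ i \<noteq> l $ i" using assms(3) by (auto simp: vec_eq_iff)
  have "k $ i - l $ i \<in> \<int>" using assms(1,2) by (auto simp: int_lattice_def)
  then obtain z where z: "k $ i - l $ i = of_int z" by (auto elim: Ints_cases)
  with i have "z \<noteq> 0" by auto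
  then have "1 \<le> \<bar>(k - l) $ i\<bar>" by (simp add: z flip: of_int_abs)
  also have "\<dots> \<le> dist k l" unfolding dist_norm by (rule component_le_norm_cart)
  finally show ?thesis .
qed

lemma uminus_int_lattice: "k \<in> int_lattice \<Longrightarrow> - k \<in> int_lattice"
  by (simp add: int_lattice_def)

text \<open>The lattice lies in countably many hyperplanes, on each of which the \<open>i\<close>-th coordinate is a fixed
  integer.\<close>

lemma negligible_int_lattice: "negligible (int_lattice :: (real^'d) set)"
proof -
  fix i :: 'd
  have "negligible (\<Union> (range (\<lambda>z::int. {x::real^'d. x $ i = of_int z})))"
  proof (rule negligible_countable_Union)
    fix S assume "S \<in> range (\<lambda>z::int. {x::real^'d. x $ i = of_int z})"
    then obtain z :: int where "S = {x. axis i 1 \<bullet> x = of_int z}" by (auto simp: inner_axis')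
    then show "negligible S" by (simp add: negligible_hyperplane)
  qed simp
  moreover have "(int_lattice :: (real^'d) set) \<subseteq> (\<Union>z::int. {x. x $ i = of_int z})"
    by (auto simp: int_lattice_def elim!: allE[where x = i] Ints_cases)
  ultimately show ?thesis by (rule negligible_subset)
qed

text \<open>A point off the lattice has a coordinate that is not an integer; the distance of this coordinate
  to the integers bounds the distance of the point to the lattice from below. Together with
  \<open>negligible_int_lattice\<close> it shows that the neighbourhoods shrink to a null set.\<close>

lemma eventually_notin_lattice_nbhd:
  fixes x :: "real^'d"
  assumes x: "x \<notin> int_lattice" and e: "e \<longlonglongrightarrow> 0"
  shows "\<forall>\<^sub>F n in sequentially. x \<notin> lattice_nbhd (e n)"
proof -
  obtain i where i: "x $ i \<notin> \<int>" using x by (auto simp: int_lattice_def)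
  define \<delta> where "\<delta> = min (frac (x $ i)) (1 - frac (x $ i))"
  have "0 < \<delta>" using i frac_lt_1[of "x $ i"] by (simp add: \<delta>_def frac_gt_0_iff)
  have far: "\<delta> \<le> dist k x" if k: "k \<in> int_lattice" for k
  proof -
    obtain z where z: "k $ i = of_int z" using k by (auto simp: int_lattice_def elim!: allE[where x = i] Ints_cases)
    have "\<delta> \<le> \<bar>of_int z - x $ i\<bar>"
    proof (cases "z \<le> \<lfloor>x $ i\<rfloor>")
      case True
      then have "of_int z \<le> (of_int \<lfloor>x $ i\<rfloor> :: real)" by simp
      then show ?thesis by (simp add: \<delta>_def frac_def)
    next
      case False
      then have "\<lfloor>x $ i\<rfloor> + 1 \<le> z" by simp
      then have "of_int (\<lfloor>x $ i\<rfloor> + 1) \<le> (of_int z :: real)" by (rule of_int_le_iff[THEN iffD2])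
      then show ?thesis by (simp add: \<delta>_def frac_def)
    qed
    also have "\<dots> = \<bar>(k - x) $ i\<bar>" by (simp add: z)
    also have "\<dots> \<le> dist k x" unfolding dist_norm by (rule component_le_norm_cart)
    finally show ?thesis .
  qed
  have "\<forall>\<^sub>F n in sequentially. e n < \<delta>" using e \<open>0 < \<delta>\<close> by (rule order_tendstoD)
  then show ?thesis
  proof eventually_elim
    case (elim n)
    then show ?case using far by (force simp: lattice_nbhd_def)
  qed
qed

definition energy_on :: "(real^'d) set \<Rightarrow> (real^'d \<Rightarrow> complex) \<Rightarrow> ennreal" where
  "energy_on S f = (\<integral>\<^sup>+x. indicator S x * ennreal ((cmod (f x))\<^sup>2) \<partial>lebesgue)"

lemma energy_on_UNIV: "energy_on UNIV f = energy f"
  by (simp add: energy_on_def energy_def)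

lemma energy_on_mono:
  assumes "S \<subseteq> T"
  shows "energy_on S f \<le> energy_on T f"
  unfolding energy_on_def
proof (intro nn_integral_mono mult_right_mono)
  show "indicator S x \<le> (indicator T x :: ennreal)" for x
    using assms by (cases "x \<in> S") auto
qed simp

lemma energy_on_le_energy: "energy_on S f \<le> energy f"
  using energy_on_mono[of S UNIV f] by (simp add: energy_on_UNIV)

lemma measurable_indicator_energy:
  assumes "S \<in> sets lebesgue" "f \<in> borel_measurable lebesgue"
  shows "(\<lambda>x. indicator S x * ennreal ((cmod (f x))\<^sup>2)) \<in> borel_measurable lebesgue"
  using assms by measurable

text \<open>Distinct lattice points have distance at least 1, so balls of radius at most 1/2 around them are
  disjoint. The centres are \<open>- k\<close> because translating the integration variable by \<open>k\<close> produces them.\<close>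

lemma sum_energy_on_balls_le:
  fixes h :: "real^'d \<Rightarrow> complex"
  assumes h: "h \<in> borel_measurable lebesgue" and e: "e \<le> 1/2"
    and F: "finite F" "F \<subseteq> int_lattice"
  shows "(\<Sum>k\<in>F. energy_on (ball (- k) e) h) \<le> energy_on (lattice_nbhd e) h"
proof -
  have neg: "- k \<in> int_lattice" if "k \<in> F" for k
    by (rule uminus_int_lattice) (rule subsetD[OF F(2) that])
  have disj: "disjoint_family_on (\<lambda>k. ball (- k) e) F"
    unfolding disjoint_family_on_def
  proof (intro ballI impI, rule ccontr)
    fix k l assume kl: "k \<in> F" "l \<in> F" "k \<noteq> l" "ball (- k) e \<inter> ball (- l) e \<noteq> {}"
    then obtain x where "x \<in> ball (- k) e" "x \<in> ball (- l) e" by blast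
    then have "dist (- k) x < e" "dist (- l) x < e" by (simp_all only: mem_ball)
    then have "dist (- k) (- l) < 1" using dist_triangle2[of "- k" "- l" x] e by linarith
    moreover have "1 \<le> dist (- k) (- l)"
      by (rule int_lattice_separated[OF neg[OF kl(1)] neg[OF kl(2)]]) (simp add: kl(3))
    ultimately show False by linarith
  qed
  have "(\<Sum>k\<in>F. energy_on (ball (- k) e) h)
      = (\<integral>\<^sup>+x. (\<Sum>k\<in>F. indicator (ball (- k) e) x * ennreal ((cmod (h x))\<^sup>2)) \<partial>lebesgue)"
    unfolding energy_on_def by (intro nn_integral_sum[symmetric] measurable_indicator_energy h) simp
  also have "\<dots> = energy_on (\<Union>k\<in>F. ball (- k) e) h"
    by (simp only: energy_on_def indicator_UN_disjoint[OF F(1) disj] sum_distrib_right)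
  also have "\<dots> \<le> energy_on (lattice_nbhd e) h"
  proof (rule energy_on_mono)
    show "(\<Union>k\<in>F. ball (- k) e) \<subseteq> lattice_nbhd e"
      unfolding lattice_nbhd_def by (intro UN_least UN_upper neg)
  qed
  finally show ?thesis .
qed

text \<open>The Cauchy-Schwarz inequality on the small support of \<open>g\<close> sees only the part of \<open>h\<close> near one lattice
  point; the pieces that belong to different \<open>k\<close> are disjoint, so that their sum is an integral over
  the neighbourhood of the whole lattice.\<close>

lemma translates_inner_sum_le:
  fixes g h :: "real^'d \<Rightarrow> complex"
  assumes g: "g \<in> L2" and h: "h \<in> L2" and e: "e \<le> 1/2" and supp: "\<And>x. e \<le> norm x \<Longrightarrow> g x = 0"
  shows "(\<Sum>\<^sub>\<infinity>k\<in>int_lattice. ennreal ((cmod (L2_inner g (dilate_shift (mat 1) k h)))\<^sup>2))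
    \<le> energy g * energy_on (lattice_nbhd e) h"
proof (rule infsum_le_finite_sums)
  fix F :: "(real^'d) set" assume F: "finite F" "F \<subseteq> int_lattice"
  have one: "invertible (mat 1 :: real^'d^'d)" by (simp add: invertible_def)
  note [measurable] = L2_measurable[OF h]
  have "ennreal ((cmod (L2_inner g (dilate_shift (mat 1) k h)))\<^sup>2) \<le> energy g * energy_on (ball (- k) e) h" for k
  proof -
    let ?G = "\<lambda>y. indicator (ball (- k) e) y * ennreal ((cmod (h y))\<^sup>2)"
    have "ennreal ((cmod (L2_inner g (dilate_shift (mat 1) k h)))\<^sup>2)
        \<le> energy g * (\<integral>\<^sup>+x. indicator (ball 0 e) x * ennreal ((cmod (dilate_shift (mat 1) k h x))\<^sup>2) \<partial>lebesgue)"
      using supp by (intro L2_inner_Cauchy_Schwarz_on g dilate_shift_L2 one h) auto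
    also have "(\<integral>\<^sup>+x. indicator (ball 0 e) x * ennreal ((cmod (dilate_shift (mat 1) k h x))\<^sup>2) \<partial>lebesgue)
        = (\<integral>\<^sup>+x. ?G (mat 1 *v x - k) \<partial>lebesgue)"
      by (intro nn_integral_cong) (auto simp: dilate_shift_def dist_norm norm_minus_commute split: split_indicator)
    also have "\<dots> = ennreal (1 / \<bar>det (mat 1 :: real^'d^'d)\<bar>) * (\<integral>\<^sup>+x. ?G x \<partial>lebesgue)"
      by (intro nn_integral_matrix_affine[OF one] measurable_indicator_energy L2_measurable h) simp
    finally show ?thesis by (simp add: energy_on_def)
  qed
  then have "(\<Sum>k\<in>F. ennreal ((cmod (L2_inner g (dilate_shift (mat 1) k h)))\<^sup>2))
      \<le> energy g * (\<Sum>k\<in>F. energy_on (ball (- k) e) h)"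
    unfolding sum_distrib_left by (intro sum_mono)
  also have "\<dots> \<le> energy g * energy_on (lattice_nbhd e) h"
    by (intro mult_left_mono sum_energy_on_balls_le L2_measurable h e F) simp
  finally show "(\<Sum>k\<in>F. ennreal ((cmod (L2_inner g (dilate_shift (mat 1) k h)))\<^sup>2))
      \<le> energy g * energy_on (lattice_nbhd e) h" .
qed simp

lemma energy_on_lattice_nbhd_tendsto_zero:
  fixes h :: "real^'d \<Rightarrow> complex"
  assumes h: "h \<in> L2" and e: "e \<longlonglongrightarrow> 0"
  shows "(\<lambda>n. energy_on (lattice_nbhd (e n)) h) \<longlonglongrightarrow> 0"
proof -
  note [measurable] = L2_measurable[OF h] lattice_nbhd_sets
  let ?s = "\<lambda>n x. indicator (lattice_nbhd (e n)) x * ennreal ((cmod (h x))\<^sup>2)"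
  have "(\<lambda>n. \<integral>\<^sup>+x. ?s n x \<partial>lebesgue) \<longlonglongrightarrow> (\<integral>\<^sup>+x. 0 \<partial>(lebesgue :: (real^'d) measure))"
  proof (rule nn_integral_dominated_convergence[where w = "\<lambda>x. ennreal ((cmod (h x))\<^sup>2)"])
    show "(\<integral>\<^sup>+x. ennreal ((cmod (h x))\<^sup>2) \<partial>lebesgue) < \<infinity>"
      using h by (simp add: L2_iff_energy energy_def)
    have "AE x in lebesgue. (x :: real^'d) \<notin> int_lattice"
      using negligible_int_lattice by (auto simp: negligible_iff_null_sets intro: AE_not_in)
    then show "AE x in lebesgue. (\<lambda>n. ?s n x) \<longlonglongrightarrow> 0"
    proof eventually_elim
      case (elim x)
      have "\<forall>\<^sub>F n in sequentially. ?s n x = 0"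
        using eventually_notin_lattice_nbhd[OF elim e] by eventually_elim simp
      then show ?case by (rule tendsto_eventually)
    qed
  qed (auto split: split_indicator)
  then show ?thesis by (simp add: energy_on_def)
qed

text \<open>The sum over \<open>A\<close> is dominated by an integral over the counting measure, which makes dominated
  convergence available also for an uncountable index set; the dominating function \<open>a \<mapsto> energy (\<phi> a)\<close>
  is integrable by the summability hypothesis.\<close>

lemma sum_energy_on_lattice_nbhd_tendsto_zero:
  fixes \<phi> :: "'i \<Rightarrow> real^'d \<Rightarrow> complex"
  assumes \<phi>: "\<And>a. a \<in> A \<Longrightarrow> \<phi> a \<in> L2" and summable: "(\<lambda>a. (L2_norm (\<phi> a))\<^sup>2) summable_on A"
    and e: "e \<longlonglongrightarrow> 0"
  shows "(\<lambda>n. \<Sum>\<^sub>\<infinity>a\<in>A. energy_on (lattice_nbhd (e n)) (\<phi> a)) \<longlonglongrightarrow> 0"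
proof (rule tendsto_sandwich[OF _ _ tendsto_const])
  have "integrable (count_space A) (\<lambda>a. (L2_norm (\<phi> a))\<^sup>2)"
    by (rule summable[THEN summable_on_iff_abs_summable_on_real[THEN iffD1],
          THEN abs_summable_equivalent[THEN iffD1], unfolded Infinite_Set_Sum.abs_summable_on_def])
  then have "(\<integral>\<^sup>+a. ennreal ((L2_norm (\<phi> a))\<^sup>2) \<partial>count_space A) < \<infinity>"
    by (simp add: integrable_iff_bounded)
  also have "(\<integral>\<^sup>+a. ennreal ((L2_norm (\<phi> a))\<^sup>2) \<partial>count_space A) = (\<integral>\<^sup>+a. energy (\<phi> a) \<partial>count_space A)"
    by (intro nn_integral_cong) (simp add: L2_norm_eq_energy \<phi>)
  finally have fin: "(\<integral>\<^sup>+a. energy (\<phi> a) \<partial>count_space A) < \<infinity>" .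
  have "(\<lambda>n. \<integral>\<^sup>+a. energy_on (lattice_nbhd (e n)) (\<phi> a) \<partial>count_space A) \<longlonglongrightarrow> (\<integral>\<^sup>+a. 0 \<partial>count_space A)"
    by (rule nn_integral_dominated_convergence[OF _ _ _ _ fin])
      (auto simp: AE_count_space energy_on_le_energy intro!: energy_on_lattice_nbhd_tendsto_zero \<phi> e)
  then show "(\<lambda>n. \<integral>\<^sup>+a. energy_on (lattice_nbhd (e n)) (\<phi> a) \<partial>count_space A) \<longlonglongrightarrow> 0"
    by simp
qed (auto intro!: always_eventually infsum_le_nn_integral_count_space)

section \<open>Vanishing of the coarse part\<close>

text \<open>Level \<open>- n\<close> at \<open>f\<close> is level 0 at the dilate of \<open>f\<close> by \<open>M^n\<close>, whose support is the image of the
  ball of radius \<open>R\<close> under \<open>M^{-n}\<close> and hence small for large \<open>n\<close>.\<close>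

lemma level_sum_coarse_le:
  fixes M :: "real^'d^'d"
  assumes M: "invertible M" "expansive M" and \<phi>: "\<And>a. a \<in> A \<Longrightarrow> \<phi> a \<in> L2"
    and f: "f \<in> L2" and supp: "\<And>x. R < norm x \<Longrightarrow> f x = 0" and R: "0 \<le> R" and e: "0 < e" "e \<le> 1/2"
  shows "\<forall>\<^sub>F n in sequentially. level_sum M (- int n) A \<phi> f \<le> energy f * (\<Sum>\<^sub>\<infinity>a\<in>A. energy_on (lattice_nbhd e) (\<phi> a))"
  using matrix_power_inv_small_on_ball[OF M e(1) R]
proof eventually_elim
  case (elim n)
  let ?U = "matrix_powi M (int n)"
  let ?g = "dilate_shift ?U 0 f"
  have U: "invertible ?U" by (rule invertible_matrix_powi[OF M(1)])
  have g: "?g \<in> L2" by (rule dilate_shift_L2[OF U f])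
  have inv: "matrix_power (matrix_inv M) n ** ?U = mat 1"
    by (simp add: matrix_powi_uminus_nat[symmetric] matrix_powi_0 flip: matrix_powi_add[OF M(1)])
  have supp_g: "?g x = 0" if x: "e \<le> norm x" for x
  proof -
    have "matrix_power (matrix_inv M) n *v (?U *v x) = x"
      by (simp add: matrix_vector_mul_assoc inv)
    with elim[rule_format, of "?U *v x"] x have "R < norm (?U *v x)" by force
    then show ?thesis by (simp add: dilate_shift_def supp)
  qed
  have "level_sum M (- int n) A \<phi> f = level_sum M 0 A \<phi> ?g"
    using level_sum_dilate[OF M(1) f, where j = "- int n" and n = "int n" and \<phi> = \<phi> and A = A] \<phi> by simp
  also have "\<dots> \<le> (\<Sum>\<^sub>\<infinity>a\<in>A. energy ?g * energy_on (lattice_nbhd e) (\<phi> a))"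
    unfolding level_sum_def matrix_powi_0
    by (intro infsum_mono translates_inner_sum_le g \<phi> e supp_g) auto
  also have "\<dots> \<le> energy ?g * (\<Sum>\<^sub>\<infinity>a\<in>A. energy_on (lattice_nbhd e) (\<phi> a))"
    by (rule infsum_cmult_ennreal_le)
  also have "energy ?g = energy f" by (rule energy_dilate_shift[OF U L2_measurable[OF f]])
  finally show ?case .
qed

section \<open>The homogeneous system\<close>

definition truncate :: "real \<Rightarrow> (real^'d \<Rightarrow> complex) \<Rightarrow> real^'d \<Rightarrow> complex" where
  "truncate R f = (\<lambda>x. if norm x \<le> R then f x else 0)"

lemma truncate_L2:
  assumes "f \<in> L2"
  shows "truncate R f \<in> L2"
proof -
  have "truncate R f = (\<lambda>x. indicator (cball 0 R) x *\<^sub>R f x)"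
    by (auto simp: truncate_def indicator_def)
  then have "truncate R f \<in> borel_measurable lebesgue"
    by (simp only:) (intro borel_measurable_scaleR borel_measurable_indicator L2_measurable assms, simp)
  moreover have "energy (truncate R f) \<le> energy f"
    unfolding energy_def truncate_def by (intro nn_integral_mono) auto
  ultimately show ?thesis using assms by (auto simp: L2_iff_energy)
qed

lemma energy_truncation_error_tendsto_zero:
  fixes f :: "real^'d \<Rightarrow> complex"
  assumes f: "f \<in> L2"
  shows "(\<lambda>m. energy (\<lambda>x. f x - truncate (real m) f x)) \<longlonglongrightarrow> 0"
proof -
  note [measurable] = L2_measurable[OF f] L2_measurable[OF truncate_L2[OF f]]
  let ?s = "\<lambda>m x. ennreal ((cmod (f x - truncate (real m) f x))\<^sup>2)"
  have "(\<lambda>m. \<integral>\<^sup>+x. ?s m x \<partial>lebesgue) \<longlonglongrightarrow> (\<integral>\<^sup>+x. 0 \<partial>(lebesgue :: (real^'d) measure))"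
  proof (rule nn_integral_dominated_convergence[where w = "\<lambda>x. ennreal ((cmod (f x))\<^sup>2)"])
    show "(\<integral>\<^sup>+x. ennreal ((cmod (f x))\<^sup>2) \<partial>lebesgue) < \<infinity>"
      using f by (simp add: L2_iff_energy energy_def)
    have "(\<lambda>m. ?s m x) \<longlonglongrightarrow> 0" for x
    proof (rule tendsto_eventually)
      obtain m0 where "norm x \<le> real m0" using real_arch_simple by blast
      then have "?s m x = 0" if "m0 \<le> m" for m
        using that by (simp add: truncate_def order_trans[OF _ of_nat_mono])
      then show "\<forall>\<^sub>F m in sequentially. ?s m x = 0" by (auto simp: eventually_sequentially)
    qed
    then show "AE x in lebesgue. (\<lambda>m. ?s m x) \<longlonglongrightarrow> 0" by simp
    show "AE x in lebesgue. ?s m x \<le> ennreal ((cmod (f x))\<^sup>2)" for m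
      by (simp add: truncate_def)
  qed measurable
  then show ?thesis by (simp add: energy_def)
qed


lemma homogeneous_sum_le:
  assumes frame: "\<And>J. nonhomogeneous_wavelet_frame M J A \<phi> B \<psi> C\<^sub>1 C\<^sub>2" and f: "f \<in> L2"
  shows "(\<Sum>\<^sub>\<infinity>j\<in>UNIV. level_sum M j B \<psi> f) \<le> ennreal (C\<^sub>2 * (L2_norm f)\<^sup>2)"
proof (rule infsum_le_finite_sums)
  fix F :: "int set" assume F: "finite F"
  define J where "J = Min (insert 0 F)"
  have "F \<subseteq> {J..}" using F by (auto simp: J_def)
  then have "(\<Sum>j\<in>F. level_sum M j B \<psi> f) \<le> (\<Sum>\<^sub>\<infinity>j\<in>{J..}. level_sum M j B \<psi> f)"
    using F by (intro finite_sum_le_infsum_ennreal)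
  also have "\<dots> \<le> level_sum M J A \<phi> f + (\<Sum>\<^sub>\<infinity>j\<in>{J..}. level_sum M j B \<psi> f)"
    by simp
  also have "\<dots> \<le> ennreal (C\<^sub>2 * (L2_norm f)\<^sup>2)"
    using frame[of J] f by (simp add: nonhomogeneous_wavelet_frame_def)
  finally show "(\<Sum>j\<in>F. level_sum M j B \<psi> f) \<le> ennreal (C\<^sub>2 * (L2_norm f)\<^sup>2)" .
qed simp

text \<open>Three parameters are sent to their limits in turn. For a truncation radius \<open>m\<close> and a neighbourhood
  size \<open>e i\<close>, a level \<open>- n\<close> that is coarse enough gives the inequality \<open>step\<close>, which no longer mentions
  \<open>n\<close>. Then \<open>i \<rightarrow> \<infinity>\<close> removes the contribution of the truncated function, and \<open>m \<rightarrow> \<infinity>\<close> that of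
  the remainder.\<close>

lemma homogeneous_sum_ge:
  fixes M :: "real^'d^'d"
  assumes M: "invertible M" "expansive M"
    and \<phi>: "\<And>a. a \<in> A \<Longrightarrow> \<phi> a \<in> L2" and summable: "(\<lambda>a. (L2_norm (\<phi> a))\<^sup>2) summable_on A"
    and frame: "\<And>J. nonhomogeneous_wavelet_frame M J A \<phi> B \<psi> C\<^sub>1 C\<^sub>2" and f: "f \<in> L2"
  shows "ennreal (C\<^sub>1 * (L2_norm f)\<^sup>2) \<le> (\<Sum>\<^sub>\<infinity>j\<in>UNIV. level_sum M j B \<psi> f)" (is "?c \<le> ?S")
proof -
  define e :: "nat \<Rightarrow> real" where "e i = inverse (real (Suc (Suc i)))" for i
  define T where "T i = (\<Sum>\<^sub>\<infinity>a\<in>A. energy_on (lattice_nbhd (e i)) (\<phi> a))" for i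
  define r where "r m = (\<lambda>x. f x - truncate (real m) f x)" for m
  have e: "0 < e i" "e i \<le> 1/2" for i by (auto simp: e_def field_simps)
  have "e \<longlonglongrightarrow> 0" unfolding e_def by (rule LIMSEQ_Suc[OF LIMSEQ_inverse_real_of_nat])
  then have T: "T \<longlonglongrightarrow> 0"
    unfolding T_def by (intro sum_energy_on_lattice_nbhd_tendsto_zero \<phi> summable)
  have r: "r m \<in> L2" for m unfolding r_def by (intro L2_diff truncate_L2 f)
  have C2: "0 \<le> C\<^sub>2" using frame[of 0] by (simp add: nonhomogeneous_wavelet_frame_def)
  have step: "?c \<le> 2 * (energy (truncate (real m) f) * T i) + 2 * (ennreal C\<^sub>2 * energy (r m)) + ?S" for m i
  proof -
    let ?t = "truncate (real m) f"
    have t: "?t \<in> L2" by (rule truncate_L2[OF f])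
    have "\<forall>\<^sub>F n in sequentially. level_sum M (- int n) A \<phi> ?t \<le> energy ?t * T i"
      unfolding T_def by (rule level_sum_coarse_le[OF M \<phi> t _ _ e, where R = "real m"]) (auto simp: truncate_def)
    then obtain n where n: "level_sum M (- int n) A \<phi> ?t \<le> energy ?t * T i"
      by (auto simp: eventually_sequentially)
    let ?J = "- int n"
    have "level_sum M ?J A \<phi> (r m) \<le> level_sum M ?J A \<phi> (r m) + (\<Sum>\<^sub>\<infinity>j\<in>{?J..}. level_sum M j B \<psi> (r m))"
      by simp
    also have "\<dots> \<le> ennreal (C\<^sub>2 * (L2_norm (r m))\<^sup>2)"
      using frame[of ?J] r[of m] by (simp add: nonhomogeneous_wavelet_frame_def)
    also have "\<dots> = ennreal C\<^sub>2 * energy (r m)"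
      by (simp add: ennreal_mult C2 L2_norm_eq_energy[OF r])
    \<comment> \<open>The upper frame bound at the same coarse level; it does not depend on \<open>n\<close>.\<close>
    finally have rest: "level_sum M ?J A \<phi> (r m) \<le> ennreal C\<^sub>2 * energy (r m)" .
    have "level_sum M ?J A \<phi> (\<lambda>x. ?t x + r m x) \<le> 2 * level_sum M ?J A \<phi> ?t + 2 * level_sum M ?J A \<phi> (r m)"
      by (intro level_sum_add_le M(1) t r \<phi>)
    then have "level_sum M ?J A \<phi> f \<le> 2 * level_sum M ?J A \<phi> ?t + 2 * level_sum M ?J A \<phi> (r m)"
      by (simp add: r_def)
    also have "\<dots> \<le> 2 * (energy ?t * T i) + 2 * (ennreal C\<^sub>2 * energy (r m))"
      by (intro add_mono mult_left_mono n rest) auto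
    finally have coarse: "level_sum M ?J A \<phi> f \<le> 2 * (energy ?t * T i) + 2 * (ennreal C\<^sub>2 * energy (r m))" .
    have fine: "(\<Sum>\<^sub>\<infinity>j\<in>{?J..}. level_sum M j B \<psi> f) \<le> ?S"
      by (intro infsum_mono_neutral) auto
    have "?c \<le> level_sum M ?J A \<phi> f + (\<Sum>\<^sub>\<infinity>j\<in>{?J..}. level_sum M j B \<psi> f)"
      using frame[of ?J] f by (simp add: nonhomogeneous_wavelet_frame_def)
    also have "\<dots> \<le> 2 * (energy ?t * T i) + 2 * (ennreal C\<^sub>2 * energy (r m)) + ?S"
      by (intro add_mono coarse fine)
    finally show ?thesis .
  qed
  have "?c \<le> 2 * (ennreal C\<^sub>2 * energy (r m)) + ?S" for m
  proof -
    have "energy (truncate (real m) f) < top" using truncate_L2[OF f] by (simp add: L2_iff_energy)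
    then have "(\<lambda>i. 2 * (energy (truncate (real m) f) * T i) + 2 * (ennreal C\<^sub>2 * energy (r m)) + ?S)
        \<longlonglongrightarrow> 2 * (energy (truncate (real m) f) * 0) + 2 * (ennreal C\<^sub>2 * energy (r m)) + ?S"
      by (intro tendsto_add tendsto_const ennreal_tendsto_cmult T) auto
    from LIMSEQ_le_const[OF this] step show ?thesis by simp
  qed
  moreover have "(\<lambda>m. 2 * (ennreal C\<^sub>2 * energy (r m)) + ?S) \<longlonglongrightarrow> 2 * (ennreal C\<^sub>2 * 0) + ?S"
    unfolding r_def
    by (intro tendsto_add tendsto_const ennreal_tendsto_cmult energy_truncation_error_tendsto_zero f) auto
  ultimately show ?thesis using LIMSEQ_le_const by fastforce
qed

theorem proposition4:
  fixes M :: "real^'d^'d"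
    and A :: "'i set" and \<phi> :: "'i \<Rightarrow> real^'d \<Rightarrow> complex"
    and B :: "'j set" and \<psi> :: "'j \<Rightarrow> real^'d \<Rightarrow> complex"
    and C\<^sub>1 C\<^sub>2 :: real and J\<^sub>0 :: int
  assumes "invertible M"
    and "\<And>a. a \<in> A \<Longrightarrow> \<phi> a \<in> L2"
    and "\<And>b. b \<in> B \<Longrightarrow> \<psi> b \<in> L2"
    and "nonhomogeneous_wavelet_frame M J\<^sub>0 A \<phi> B \<psi> C\<^sub>1 C\<^sub>2"
  shows "(\<forall>J. nonhomogeneous_wavelet_frame M J A \<phi> B \<psi> C\<^sub>1 C\<^sub>2) \<and>
    (expansive M \<and> (\<lambda>a. (L2_norm (\<phi> a))\<^sup>2) summable_on A
       \<longrightarrow> homogeneous_wavelet_frame M B \<psi> C\<^sub>1 C\<^sub>2)"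
proof (intro conjI impI allI)
  show all: "nonhomogeneous_wavelet_frame M J A \<phi> B \<psi> C\<^sub>1 C\<^sub>2" for J
    using assms by (rule nonhomogeneous_wavelet_frame_all_levels)
  assume *: "expansive M \<and> (\<lambda>a. (L2_norm (\<phi> a))\<^sup>2) summable_on A"
  have "0 < C\<^sub>1" "0 < C\<^sub>2" using assms(4) by (auto simp: nonhomogeneous_wavelet_frame_def)
  then show "homogeneous_wavelet_frame M B \<psi> C\<^sub>1 C\<^sub>2"
    unfolding homogeneous_wavelet_frame_def
    using homogeneous_sum_ge[OF assms(1) _ assms(2) _ all] homogeneous_sum_le[OF all] * by blast
qed

end
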